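(* Consider the physical system with state $(\boldsymbol{\omega},\boldsymbol{\delta})\in\mathbb{R}^N\times\mathbb{R}^N$, input $\mathbf{P}\in\mathbb{R}^N$ and output $\boldsymbol{\omega}$, given by $$\dot{\boldsymbol{\delta}}=\boldsymbol{\omega},\qquad M\dot{\boldsymbol{\omega}}+D\boldsymbol{\omega}+T\boldsymbol{\delta}=\mathbf{P},$$ where $M=\mathrm{diag}\{M_i\}$ and $D=\mathrm{diag}\{D_i\}$ with $M_i>0$, $D_i>0$ for $i=1,\dots,N$, and $T\in\mathbb{R}^{N\times N}$ is the synchronizing torque coefficient matrix, i.e. $T_{ij}=-t_{ij}$ for $i\ne j$ and $T_{ii}=\sum_{j\neq i}t_{ij}$, with $t_{ij}=t_{ji}\ge 0$ for all $i\neq j$. Then this system is output strictly passive from input $\mathbf{P}$ to output $\boldsymbol{\omega}$.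
   Context: A system $\dot x=f(x,u)$, $y=h(x,u)$ with state $x\in\mathbb{R}^n$, input $u\in\mathbb{R}^p$, output $y\in\mathbb{R}^p$ is called output strictly passive (OSP) from $u$ to $y$ if there exist a (differentiable) positive semidefinite function $S:\mathbb{R}^n\to\mathbb{R}_+$ (storage function) and a scalar $\delta_y>0$ such that $\dot S=\frac{\partial S}{\partial x}f(x,u)\le y^{T}u-\delta_y\|y\|^2$ for all $x\in\mathbb{R}^n$ and all $u\in\mathbb{R}^p$. *)

theory Defs
  imports "HOL-Analysis.Analysis"
begin

text \<open>
  A system \<open>x' = f x u\<close>, \<open>y = h x u\<close> is given by its vector field \<open>f\<close> and output map \<open>h\<close>; the
  input and the output live in the same space. Following the usual convention for positive
  semidefinite functions, a storage function is nonnegative and vanishes at the origin.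
\<close>

definition positive_semidefinite_fun :: "('x::euclidean_space \<Rightarrow> real) \<Rightarrow> bool" where
  "positive_semidefinite_fun S \<longleftrightarrow> S 0 = 0 \<and> (\<forall>x. 0 \<le> S x)"

definition output_strictly_passive ::
  "('x::euclidean_space \<Rightarrow> 'u::euclidean_space \<Rightarrow> 'x) \<Rightarrow> ('x \<Rightarrow> 'u \<Rightarrow> 'u) \<Rightarrow> bool" where
  "output_strictly_passive f h \<longleftrightarrow>
    (\<exists>S \<delta>\<^sub>y. positive_semidefinite_fun S \<and> (\<forall>x. S differentiable (at x)) \<and> \<delta>\<^sub>y > 0 \<and>
      (\<forall>x u. frechet_derivative S (at x) (f x u) \<le> h x u \<bullet> u - \<delta>\<^sub>y * (norm (h x u))\<^sup>2))"

definition diag_matrix :: "('n::finite \<Rightarrow> real) \<Rightarrow> real ^ 'n ^ 'n" where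
  "diag_matrix d = (\<chi> i j. if i = j then d i else 0)"

text \<open>The diagonal values \<open>t i i\<close> are not used.\<close>

definition torque_matrix :: "('n::finite \<Rightarrow> 'n \<Rightarrow> real) \<Rightarrow> real ^ 'n ^ 'n" where
  "torque_matrix t = (\<chi> i j. if i = j then (\<Sum>k\<in>UNIV - {i}. t i k) else - t i j)"

text \<open>
  The state is the pair \<open>(\<omega>, \<delta>)\<close>. The second equation determines the \<open>\<omega>\<close>-component of the
  vector field only implicitly; it does so uniquely when \<open>M\<close> is an invertible matrix, see
  \<open>physical_vector_field_ex1\<close> below.
\<close>

definition physical_vector_field ::
  "real ^ 'n ^ 'n \<Rightarrow> real ^ 'n ^ 'n \<Rightarrow> real ^ 'n ^ 'n \<Rightarrow>
    ((real ^ 'n) \<times> (real ^ 'n) \<Rightarrow> real ^ 'n \<Rightarrow> (real ^ 'n) \<times> (real ^ 'n)) \<Rightarrow> bool" where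
  "physical_vector_field M D T f \<longleftrightarrow>
    (\<forall>\<omega> \<delta> P. snd (f (\<omega>, \<delta>) P) = \<omega> \<and>
              M *v fst (f (\<omega>, \<delta>) P) + D *v \<omega> + T *v \<delta> = P)"

lemma diag_matrix_mult_vec: "diag_matrix d *v x = (\<chi> i. d i * x $ i)"
  by (simp add: vec_eq_iff matrix_vector_mult_def diag_matrix_def if_distrib if_distribR cong: if_cong)

lemma physical_vector_field_ex1:
  fixes m :: "'n::finite \<Rightarrow> real"
  assumes "\<And>i. m i > 0"
  shows "\<exists>!f. physical_vector_field (diag_matrix m) D T f"
proof
  let ?f = "\<lambda>(\<omega>, \<delta>) P. ((\<chi> i. (P - D *v \<omega> - T *v \<delta>) $ i / m i), \<omega>)"
  have [simp]: "m i \<noteq> 0" for i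
    using assms[of i] by simp
  show "physical_vector_field (diag_matrix m) D T ?f"
    by (simp add: physical_vector_field_def diag_matrix_mult_vec vec_eq_iff)
  fix g assume g: "physical_vector_field (diag_matrix m) D T g"
  show "g = ?f"
  proof (intro ext, clarify)
    fix \<omega> \<delta> P
    have 1: "snd (g (\<omega>, \<delta>) P) = \<omega>"
      and 2: "m i * fst (g (\<omega>, \<delta>) P) $ i + (D *v \<omega>) $ i + (T *v \<delta>) $ i = P $ i" for i
      using g by (auto simp: physical_vector_field_def diag_matrix_mult_vec vec_eq_iff)
    have "fst (g (\<omega>, \<delta>) P) $ i = (P - D *v \<omega> - T *v \<delta>) $ i / m i" for i
      using 2[of i] by (simp add: field_simps)
    with 1 show "g (\<omega>, \<delta>) P = ((\<chi> i. (P - D *v \<omega> - T *v \<delta>) $ i / m i), \<omega>)"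
      by (simp add: prod_eq_iff vec_eq_iff)
  qed
qed

end

theory Submission
  imports Defs
begin

text \<open>
  The storage function is the total energy
  \<open>S (\<omega>, \<delta>) = (\<omega> \<bullet> M \<omega> + \<delta> \<bullet> T \<delta>) / 2\<close>. Since \<open>T\<close> is a weighted graph Laplacian, its quadratic
  form is a nonnegative combination of the squares \<open>(\<delta>\<^sub>i - \<delta>\<^sub>j)\<^sup>2\<close>. Along the flow the two terms
  \<open>\<omega> \<bullet> T \<delta>\<close> cancel, leaving \<open>\<omega> \<bullet> P - \<omega> \<bullet> D \<omega>\<close>, so the least damping coefficient serves as
  the passivity index.
\<close>

text \<open>The product rule yields \<open>x \<bullet> (A *v h)\<close> and
  \<open>h \<bullet> (A *v x)\<close>; symmetry of \<open>A\<close> makes the two equal, whence the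
  factor 2.\<close>

lemma has_derivative_quadratic_form:
  fixes A :: "real ^ 'n ^ 'n"
  assumes "transpose A = A"
  shows "((\<lambda>x. x \<bullet> (A *v x)) has_derivative (\<lambda>h. 2 * (h \<bullet> (A *v x)))) (at x)"
proof -
  have "x \<bullet> (A *v h) = h \<bullet> (A *v x)" for h
    using dot_lmul_matrix[of x A h]
    unfolding transpose_matrix_vector[symmetric] assms by (simp add: inner_commute)
  moreover have "((\<lambda>x. x \<bullet> (A *v x)) has_derivative (\<lambda>h. x \<bullet> (A *v h) + h \<bullet> (A *v x))) (at x)"
    by (rule has_derivative_inner[OF has_derivative_ident
          bounded_linear_imp_has_derivative[OF matrix_vector_mul_bounded_linear]])
  ultimately show ?thesis
    by simp
qed

lemma transpose_diag_matrix: "transpose (diag_matrix d) = diag_matrix d"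
  by (simp add: transpose_def diag_matrix_def vec_eq_iff)

lemma inner_diag_matrix: "x \<bullet> (diag_matrix d *v x) = (\<Sum>i\<in>UNIV. d i * (x $ i)\<^sup>2)"
  by (simp add: diag_matrix_mult_vec inner_vec_def power2_eq_square mult_ac)

text \<open>Serves twice: with \<open>c = 0\<close> for nonnegativity of the kinetic energy, and
  with the least damping coefficient for the dissipation bound.\<close>

lemma inner_diag_matrix_ge:
  assumes "\<And>i. c \<le> d i"
  shows "c * (norm x)\<^sup>2 \<le> x \<bullet> (diag_matrix d *v x)"
proof -
  have "c * (norm x)\<^sup>2 = (\<Sum>i\<in>UNIV. c * (x $ i)\<^sup>2)"
    unfolding power2_norm_eq_inner inner_vec_def sum_distrib_left
    by (simp add: power2_eq_square)
  also have "\<dots> \<le> x \<bullet> (diag_matrix d *v x)"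
    unfolding inner_diag_matrix by (intro sum_mono mult_right_mono assms) simp
  finally show ?thesis .
qed

lemma transpose_torque_matrix:
  assumes "\<And>i j. t i j = t j i"
  shows "transpose (torque_matrix t) = torque_matrix t"
  by (simp add: transpose_def torque_matrix_def vec_eq_iff assms)

text \<open>Each diagonal entry is the sum of the other weights in its row, so it supplies one
  \<open>x $ i\<close> for every \<open>- x $ j\<close>. The term \<open>j = i\<close> is zero, so
  the sum may run over all indices.\<close>

lemma torque_matrix_mult_vec:
  "torque_matrix t *v x = (\<chi> i. \<Sum>j\<in>UNIV. t i j * (x $ i - x $ j))"
proof -
  have "(\<Sum>j\<in>UNIV. torque_matrix t $ i $ j * x $ j) = (\<Sum>j\<in>UNIV. t i j * (x $ i - x $ j))" for i
    by (simp add: sum.remove[of UNIV i] torque_matrix_def sum_distrib_right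
        sum_subtractf sum_negf right_diff_distrib)
  then show ?thesis
    by (simp add: matrix_vector_mult_def)
qed

text \<open>Symmetrization: the double sum is added to its copy with \<open>i\<close> and
  \<open>j\<close> exchanged, and the two summands combine into a square.\<close>

lemma inner_torque_matrix:
  assumes "\<And>i j. t i j = t j i"
  shows "2 * (x \<bullet> (torque_matrix t *v x)) = (\<Sum>i\<in>UNIV. \<Sum>j\<in>UNIV. t i j * (x $ i - x $ j)\<^sup>2)"
proof -
  have 1: "x \<bullet> (torque_matrix t *v x) = (\<Sum>i\<in>UNIV. \<Sum>j\<in>UNIV. t i j * (x $ i - x $ j) * x $ i)"
    by (simp add: torque_matrix_mult_vec inner_vec_def sum_distrib_left mult_ac)
  \<comment> \<open>Exchange the order of summation, then use the symmetry of
    \<open>t\<close>.\<close>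
  also have "\<dots> = (\<Sum>i\<in>UNIV. \<Sum>j\<in>UNIV. t i j * (x $ j - x $ i) * x $ j)"
    by (subst sum.swap) (simp add: assms)
  finally have 2: "x \<bullet> (torque_matrix t *v x) = \<dots>" .
  have "2 * (x \<bullet> (torque_matrix t *v x)) = (\<Sum>i\<in>UNIV. \<Sum>j\<in>UNIV.
      t i j * (x $ i - x $ j) * x $ i + t i j * (x $ j - x $ i) * x $ j)"
    unfolding sum.distrib 1[symmetric] 2[symmetric] by simp
  also have "\<dots> = (\<Sum>i\<in>UNIV. \<Sum>j\<in>UNIV. t i j * (x $ i - x $ j)\<^sup>2)"
    by (intro sum.cong refl) (simp add: power2_eq_square algebra_simps)
  finally show ?thesis .
qed

lemma inner_torque_matrix_nonneg:
  assumes "\<And>i j. t i j = t j i" and "\<And>i j. i \<noteq> j \<Longrightarrow> t i j \<ge> 0"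
  shows "0 \<le> x \<bullet> (torque_matrix t *v x)"
proof -
  \<comment> \<open>On the diagonal no sign of \<open>t i i\<close> is assumed, but there the square
    vanishes.\<close>
  have "0 \<le> t i j * (x $ i - x $ j)\<^sup>2" for i j
    using assms(2) by (cases "i = j") auto
  then have "0 \<le> 2 * (x \<bullet> (torque_matrix t *v x))"
    unfolding inner_torque_matrix[OF assms(1)] by (intro sum_nonneg)
  then show ?thesis
    by simp
qed

theorem proposition4:
  fixes m d :: "'n::finite \<Rightarrow> real" and t :: "'n \<Rightarrow> 'n \<Rightarrow> real"
    and f :: "(real ^ 'n) \<times> (real ^ 'n) \<Rightarrow> real ^ 'n \<Rightarrow> (real ^ 'n) \<times> (real ^ 'n)"
  assumes "\<And>i. m i > 0"
    and "\<And>i. d i > 0"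
    and "\<And>i j. i \<noteq> j \<Longrightarrow> t i j = t j i"
    and "\<And>i j. i \<noteq> j \<Longrightarrow> t i j \<ge> 0"
    and "physical_vector_field (diag_matrix m) (diag_matrix d) (torque_matrix t) f"
  shows "output_strictly_passive f (\<lambda>(\<omega>, \<delta>) P. \<omega>)"
proof -
  let ?M = "diag_matrix m" and ?D = "diag_matrix d" and ?T = "torque_matrix t"
  have sym: "t i j = t j i" for i j
    using assms(3) by (cases "i = j") auto
  define S where "S x = (fst x \<bullet> (?M *v fst x) + snd x \<bullet> (?T *v snd x)) / 2" for x
  \<comment> \<open>The minimum over the finite index type is attained, so \<open>c\<close> is
    itself some \<open>d i\<close> and hence positive.\<close>
  define c where "c = Min (range d)"
  have c: "c > 0" "\<And>i. c \<le> d i"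
    using assms(2) by (auto simp: c_def)
  have "0 \<le> x \<bullet> (?M *v x)" for x
    using inner_diag_matrix_ge[of 0 m x] assms(1) by (simp add: less_imp_le)
  moreover have "0 \<le> x \<bullet> (?T *v x)" for x
    using sym assms(4) by (rule inner_torque_matrix_nonneg)
  ultimately have psd: "positive_semidefinite_fun S"
    by (simp add: positive_semidefinite_fun_def S_def)
  have deriv: "(S has_derivative (\<lambda>h. fst h \<bullet> (?M *v fst x) + snd h \<bullet> (?T *v snd x))) (at x)" for x
  proof -
    have "((\<lambda>x. fst x \<bullet> (?M *v fst x)) has_derivative (\<lambda>h. 2 * (fst h \<bullet> (?M *v fst x)))) (at x)"
      by (rule has_derivative_compose[OF has_derivative_fst[OF has_derivative_ident]
            has_derivative_quadratic_form[OF transpose_diag_matrix]])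
    moreover have
      "((\<lambda>x. snd x \<bullet> (?T *v snd x)) has_derivative (\<lambda>h. 2 * (snd h \<bullet> (?T *v snd x)))) (at x)"
      by (rule has_derivative_compose[OF has_derivative_snd[OF has_derivative_ident]
            has_derivative_quadratic_form[OF transpose_torque_matrix[OF sym]]])
    ultimately have "(S has_derivative
        (\<lambda>h. (2 * (fst h \<bullet> (?M *v fst x)) + 2 * (snd h \<bullet> (?T *v snd x))) / 2)) (at x)"
      unfolding S_def[abs_def]
      by (intro bounded_linear.has_derivative[OF bounded_linear_divide] has_derivative_add)
    then show ?thesis
      by (simp add: add_divide_distrib)
  qed
  have "frechet_derivative S (at (\<omega>, \<delta>)) (f (\<omega>, \<delta>) P) \<le> \<omega> \<bullet> P - c * (norm \<omega>)\<^sup>2" for \<omega> \<delta> P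
  proof -
    let ?a = "fst (f (\<omega>, \<delta>) P)"
    have snd_f: "snd (f (\<omega>, \<delta>) P) = \<omega>" and P: "?M *v ?a + ?D *v \<omega> + ?T *v \<delta> = P"
      using assms(5) by (auto simp: physical_vector_field_def)
    \<comment> \<open>Symmetry of \<open>?M\<close> moves it onto the acceleration
      \<open>?a\<close>, the form in which it occurs in the equation of motion.\<close>
    have "?a \<bullet> (?M *v \<omega>) = \<omega> \<bullet> (?M *v ?a)"
      by (simp add: diag_matrix_mult_vec inner_vec_def mult_ac)
    then have "frechet_derivative S (at (\<omega>, \<delta>)) (f (\<omega>, \<delta>) P) = \<omega> \<bullet> (?M *v ?a) + \<omega> \<bullet> (?T *v \<delta>)"
      by (simp add: frechet_derivative_at[OF deriv, symmetric] snd_f)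
    also have "\<dots> = \<omega> \<bullet> P - \<omega> \<bullet> (?D *v \<omega>)"
      \<comment> \<open>Pairing the equation of motion with \<open>\<omega>\<close> trades the
        stored power for supplied minus dissipated power.\<close>
      using arg_cong[OF P, of "inner \<omega>"] by (simp add: inner_add_right)
    also have "\<dots> \<le> \<omega> \<bullet> P - c * (norm \<omega>)\<^sup>2"
      using inner_diag_matrix_ge[of c d \<omega>] c(2) by simp
    finally show ?thesis .
  qed
  moreover have "S differentiable (at x)" for x
    using deriv differentiableI by blast
  ultimately show ?thesis
    unfolding output_strictly_passive_def using psd c(1)
    by (intro exI[of _ S] exI[of _ c]) auto
qed

end
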